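(* If $n\ge 10$, then $\mathbb{E}(P_n(2,6,n-9))>\mathbb{E}(T_n(2,2|2,2))$.
   Context: The energy $\mathbb{E}(G)$ of a graph $G$ is the sum of the absolute values of the eigenvalues of its adjacency matrix. For positive integers $a_1,\dots,a_k$ ($k\ge 3$) with $a_1+\cdots+a_k=n-1$, $P_n(a_1,\dots,a_k)$ is the tree of order $n$ consisting of a central vertex with $k$ internally disjoint pendent paths of lengths $a_1,\dots,a_k$ attached to it. For positive integers $a,b,c,d$ with $a+b+c+d\le n-2$, $T_n(a,b|c,d)$ is the tree of order $n$ obtained from the path $P_{n-a-b-c-d}$ by attaching two pendent paths of lengths $a$ and $b$ at one end vertex and two pendent paths of lengths $c$ and $d$ at the other end vertex. *)

theory Defs
  imports
    "HOL-Analysis.Analysis"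
    "Graph_Theory.Pair_Digraph"
    "Jordan_Normal_Form.Char_Poly"
begin

text \<open>
  Simple graphs are values of type \<open>'a pair_pre_digraph\<close> satisfying the locale \<open>pair_graph\<close>
  (finite, symmetric, loop-free), so every undirected edge is a pair of opposite arcs.
\<close>

text \<open>Rows and columns follow the increasing enumeration of the vertices.\<close>

definition adjacency_matrix :: "('a::linorder) pair_pre_digraph \<Rightarrow> complex mat" where
  "adjacency_matrix G =
     (let vs = sorted_list_of_set (pverts G); n = card (pverts G)
      in mat n n (\<lambda>(i, j). if (vs ! i, vs ! j) \<in> parcs G then 1 else 0))"

text \<open>
  Eigenvalues are counted with algebraic multiplicity. The matrix is taken over the complex numbers
  so that all \<open>n\<close> eigenvalues are present by definition; they are real when \<open>G\<close> is a graph, and the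
  modulus is then the absolute value.
\<close>

definition energy :: "('a::linorder) pair_pre_digraph \<Rightarrow> real" where
  "energy G =
     (\<Sum>x | eigenvalue (adjacency_matrix G) x.
        real (Polynomial.order x (char_poly (adjacency_matrix G))) * cmod x)"

text \<open>
  All graphs constructed below have vertex set \<open>{..<m}\<close>, \<open>m\<close> being the order, so that \<open>m\<close> is always
  a fresh vertex.
\<close>

definition path_graph :: "nat \<Rightarrow> nat pair_pre_digraph" where
  "path_graph m =
     \<lparr>pverts = {..<m}, parcs = {(i, j). i < m \<and> j < m \<and> (j = Suc i \<or> i = Suc j)}\<rparr>"

definition attach_leaf :: "nat \<Rightarrow> nat pair_pre_digraph \<Rightarrow> nat pair_pre_digraph" where
  "attach_leaf v G =
     (let w = card (pverts G)
      in \<lparr>pverts = insert w (pverts G), parcs = parcs G \<union> {(v, w), (w, v)}\<rparr>)"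

text \<open>
  \<open>attach_path l v G\<close> attaches at \<open>v\<close> a pendent path of length \<open>l\<close>, i.e. with \<open>l\<close> edges and \<open>l\<close> new
  vertices. After the first edge, the path continues at the vertex just added, \<open>card (pverts G)\<close>.
\<close>

primrec attach_path :: "nat \<Rightarrow> nat \<Rightarrow> nat pair_pre_digraph \<Rightarrow> nat pair_pre_digraph" where
  "attach_path 0 v G = G"
| "attach_path (Suc l) v G = attach_path l (card (pverts G)) (attach_leaf v G)"

text \<open>
  \<open>P_tree [a\<^sub>1, \<dots>, a\<^sub>k]\<close> is \<open>P\<^sub>n(a\<^sub>1, \<dots>, a\<^sub>k)\<close>; the order is determined by the lengths as
  \<open>n = a\<^sub>1 + \<dots> + a\<^sub>k + 1\<close>. The central vertex is 0.
\<close>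

definition P_tree :: "nat list \<Rightarrow> nat pair_pre_digraph" where
  "P_tree as = fold (\<lambda>a. attach_path a 0) as (path_graph 1)"

text \<open>
  \<open>T_tree n a b c d\<close> is \<open>T\<^sub>n(a, b | c, d)\<close>, meant for \<open>a + b + c + d \<le> n - 2\<close>; the subtraction
  is then exact and the two ends 0 and \<open>m - 1\<close> of the path are distinct.
\<close>

definition T_tree :: "nat \<Rightarrow> nat \<Rightarrow> nat \<Rightarrow> nat \<Rightarrow> nat \<Rightarrow> nat pair_pre_digraph" where
  "T_tree n a b c d =
     (let m = n - (a + b + c + d)
      in attach_path d (m - 1) (attach_path c (m - 1)
           (attach_path b 0 (attach_path a 0 (path_graph m)))))"

lemma pair_graph_path_graph: "pair_graph (path_graph m)"
proof unfold_locales
  show "finite (parcs (path_graph m))"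
    by (rule finite_subset[of _ "{..<m} \<times> {..<m}"]) (auto simp: path_graph_def)
qed (auto simp: path_graph_def symmetric_def sym_def)

lemma pair_graph_attach_leaf:
  assumes "pair_graph G" "pverts G = {..<m}" "v < m"
  shows "pair_graph (attach_leaf v G)" "pverts (attach_leaf v G) = {..<Suc m}"
proof -
  interpret pair_graph G by fact
  have sym: "sym (parcs G)"
    using pair_sym_arcs by (simp add: symmetric_def)
  have w: "card (pverts G) = m"
    using assms(2) by simp
  have arcs: "parcs (attach_leaf v G) = parcs G \<union> {(v, m), (m, v)}"
    and verts: "pverts (attach_leaf v G) = insert m (pverts G)"
    by (simp_all add: attach_leaf_def Let_def w)
  show "pverts (attach_leaf v G) = {..<Suc m}"
    by (simp add: verts assms(2) lessThan_Suc)
  show "pair_graph (attach_leaf v G)"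
  proof unfold_locales
    fix e assume "e \<in> parcs (attach_leaf v G)"
    then consider "e \<in> parcs G" | "e = (v, m)" | "e = (m, v)"
      unfolding arcs by blast
    note e_cases = this
    have v: "v \<in> pverts G"
      using assms(2,3) by simp
    show "fst e \<in> pverts (attach_leaf v G)"
      using e_cases by cases (use v arc_fst_in_verts verts in simp_all)
    show "snd e \<in> pverts (attach_leaf v G)"
      using e_cases by cases (use v arc_snd_in_verts verts in simp_all)
    show "fst e \<noteq> snd e"
      using e_cases by cases (use pair_no_loops assms(3) in simp_all)
  next
    show "finite (pverts (attach_leaf v G))"
      by (simp add: verts pair_finite_verts)
    show "finite (parcs (attach_leaf v G))"
      by (simp add: arcs pair_finite_arcs)
    have "sym (parcs (attach_leaf v G))"
      unfolding arcs by (intro sym_Un sym) (simp add: sym_def)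
    then show "symmetric (with_proj (attach_leaf v G))"
      by (simp add: symmetric_def)
  qed
qed

lemma pair_graph_attach_path:
  assumes "pair_graph G" "pverts G = {..<m}" "v < m"
  shows "pair_graph (attach_path l v G) \<and> pverts (attach_path l v G) = {..<m + l}"
  using assms
proof (induction l arbitrary: m v G)
  case (Suc l)
  show ?case
    using Suc.IH[OF pair_graph_attach_leaf[OF Suc.prems], of m] Suc.prems(2) by simp
qed simp

lemma pair_graph_P_tree:
  "pair_graph (P_tree as) \<and> pverts (P_tree as) = {..<Suc (sum_list as)}"
proof -
  have "pair_graph (fold (\<lambda>a. attach_path a 0) as G) \<and>
      pverts (fold (\<lambda>a. attach_path a 0) as G) = {..<m + sum_list as}"
    if "pair_graph G" "pverts G = {..<m}" "0 < m" for G m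
    using that
  proof (induction as arbitrary: G m)
    case (Cons a as)
    have step: "pair_graph (attach_path a 0 G)" "pverts (attach_path a 0 G) = {..<m + a}"
      using pair_graph_attach_path[OF Cons.prems] by blast+
    have "0 < m + a"
      using Cons.prems(3) by simp
    from Cons.IH[OF step this] show ?case
      by (simp add: add.assoc)
  qed simp
  from this[OF pair_graph_path_graph[of 1], of 1] show ?thesis
    by (simp add: P_tree_def path_graph_def)
qed

lemma pair_graph_T_tree:
  assumes "a + b + c + d < n"
  shows "pair_graph (T_tree n a b c d) \<and> pverts (T_tree n a b c d) = {..<n}"
proof -
  define m where "m = n - (a + b + c + d)"
  have m: "0 < m" "m + a + b + c + d = n"
    using assms by (auto simp: m_def)
  define G1 where "G1 = attach_path a 0 (path_graph m)"
  define G2 where "G2 = attach_path b 0 G1"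
  define G3 where "G3 = attach_path c (m - 1) G2"
  have 0: "pair_graph (path_graph m)" "pverts (path_graph m) = {..<m}"
    by (simp_all add: pair_graph_path_graph) (simp add: path_graph_def)
  have 1: "pair_graph G1" "pverts G1 = {..<m + a}"
    using pair_graph_attach_path[OF 0 m(1)] by (simp_all add: G1_def)
  have 2: "pair_graph G2" "pverts G2 = {..<m + a + b}"
    using pair_graph_attach_path[OF 1, of 0] m by (simp_all add: G2_def)
  have 3: "pair_graph G3" "pverts G3 = {..<m + a + b + c}"
    using pair_graph_attach_path[OF 2, of "m - 1"] m by (simp_all add: G3_def)
  have "T_tree n a b c d = attach_path d (m - 1) G3"
    by (simp add: T_tree_def m_def G1_def G2_def G3_def)
  then show ?thesis
    using pair_graph_attach_path[OF 3, of "m - 1" d] m by simp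
qed

end

theory Submission
  imports Defs "HOL-Real_Asymp.Real_Asymp"
begin

text \<open>
  For real numbers \<open>a\<close>, the function \<open>t ln (1 + a\<^sup>2 / t\<^sup>2) + 2 \<bar>a\<bar> arctan (t / \<bar>a\<bar>)\<close> increases from \<open>0\<close>
  to \<open>\<pi> \<bar>a\<bar>\<close> with derivative \<open>ln (t\<^sup>2 + a\<^sup>2) - ln t\<^sup>2\<close>. Summing over eigenvalues gives Coulson's
  comparison principle: if \<open>\<bar>\<phi>\<^sub>1(it)\<bar> > \<bar>\<phi>\<^sub>2(it)\<bar>\<close> for all \<open>t > 0\<close>, the energy of the first graph is larger.
  The hypothesis fails for the two trees when \<open>n\<close> is even, but it holds once \<open>\<phi>\<^sub>P\<close> is multiplied by a
  polynomial with roots \<open>\<plusminus>1, \<plusminus>4/3, \<plusminus>13/6\<close> and \<open>\<phi>\<^sub>T\<close> by one with roots \<open>\<plusminus>5/6, \<plusminus>5/3, \<plusminus>2\<close>; these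
  contribute equally to both sides because \<open>1 + 4/3 + 13/6 = 5/6 + 5/3 + 2\<close>. As functions of \<open>n\<close>, both
  \<open>\<bar>\<phi>(it)\<bar>\<close> satisfy \<open>y\<^bsub>n+2\<^esub> = t y\<^bsub>n+1\<^esub> + y\<^bsub>n\<^esub>\<close> with \<open>t > 0\<close>, hence the modified inequality only has to be
  checked for \<open>n = 10\<close> and \<open>n = 11\<close>.
\<close>

subsection \<open>Coulson's comparison principle\<close>

text \<open>An explicit antiderivative stands in for Coulson's improper integral, so only
  monotonicity and two limits are needed. For \<open>a = 0\<close> the division by \<open>0\<close>
  is harmless: its result is multiplied by \<open>0\<close>.\<close>

definition coulson :: "real \<Rightarrow> real \<Rightarrow> real" where
  "coulson a t = t * ln (1 + a\<^sup>2 / t\<^sup>2) + 2 * \<bar>a\<bar> * arctan (t / \<bar>a\<bar>)"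

lemma coulson_has_derivative:
  assumes "t > 0"
  shows "(coulson a has_real_derivative ln (t\<^sup>2 + a\<^sup>2) - ln (t\<^sup>2)) (at t)"
proof (cases "a = 0")
  case True
  then show ?thesis by (simp add: coulson_def[abs_def])
next
  case False
  have pos: "1 + a\<^sup>2 / t\<^sup>2 > 0" "t\<^sup>2 + a\<^sup>2 > 0"
    using assms by (simp_all add: add_pos_nonneg)
  have "1 + a\<^sup>2 / t\<^sup>2 = (t\<^sup>2 + a\<^sup>2) / t\<^sup>2"
    using assms by (simp add: field_simps)
  then have ln: "ln (1 + a\<^sup>2 / t\<^sup>2) = ln (t\<^sup>2 + a\<^sup>2) - ln (t\<^sup>2)"
    using pos assms by (simp add: ln_div)
  \<comment> \<open>The product-rule term \<open>e1\<close> and the arctangent term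
    \<open>e2\<close> cancel; this is why the arctangent is part of \<open>coulson\<close>.\<close>
  have e1: "t * (- (2 * a\<^sup>2 / t ^ 3) / (1 + a\<^sup>2 / t\<^sup>2)) = - (2 * a\<^sup>2 / (t\<^sup>2 + a\<^sup>2))"
    using assms pos by (simp add: divide_simps) (simp add: algebra_simps power2_eq_square power3_eq_cube)
  have e2: "2 * \<bar>a\<bar> * (1 / \<bar>a\<bar> / (1 + (t / \<bar>a\<bar>)\<^sup>2)) = 2 * a\<^sup>2 / (t\<^sup>2 + a\<^sup>2)"
    using False pos by (simp add: divide_simps)
  have "((\<lambda>t. 1 + a\<^sup>2 / t\<^sup>2) has_real_derivative - (2 * a\<^sup>2 / t ^ 3)) (at t)"
    using assms by (auto intro!: derivative_eq_intros simp: power2_eq_square power3_eq_cube mult_ac)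
  from DERIV_chain2[OF DERIV_ln_divide[OF pos(1)] this]
  have d1: "((\<lambda>t. ln (1 + a\<^sup>2 / t\<^sup>2)) has_real_derivative
      - (2 * a\<^sup>2 / t ^ 3) / (1 + a\<^sup>2 / t\<^sup>2)) (at t)"
    by (simp add: mult.commute)
  have "((\<lambda>t. t / \<bar>a\<bar>) has_real_derivative 1 / \<bar>a\<bar>) (at t)"
    by (intro DERIV_cdivide DERIV_ident)
  from DERIV_chain2[OF DERIV_arctan this]
  have d2: "((\<lambda>t. arctan (t / \<bar>a\<bar>)) has_real_derivative 1 / \<bar>a\<bar> / (1 + (t / \<bar>a\<bar>)\<^sup>2)) (at t)"
    by (simp add: field_simps)
  have "(coulson a has_real_derivative
      ln (1 + a\<^sup>2 / t\<^sup>2) + t * (- (2 * a\<^sup>2 / t ^ 3) / (1 + a\<^sup>2 / t\<^sup>2))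
        + 2 * \<bar>a\<bar> * (1 / \<bar>a\<bar> / (1 + (t / \<bar>a\<bar>)\<^sup>2))) (at t)"
    using DERIV_add[OF DERIV_mult[OF DERIV_ident d1] DERIV_cmult[OF d2, of "2 * \<bar>a\<bar>"]]
    unfolding coulson_def[abs_def] by (simp add: mult_ac add_ac)
  then show ?thesis unfolding e1 e2 ln by simp
qed

lemma coulson_at_right_0: "(coulson a \<longlongrightarrow> 0) (at_right 0)"
proof (cases "a = 0")
  case False
  then have "\<bar>a\<bar> > 0" "a\<^sup>2 > 0" by simp_all
  then show ?thesis unfolding coulson_def[abs_def] by real_asymp
qed (simp add: coulson_def[abs_def])

lemma coulson_at_top: "(coulson a \<longlongrightarrow> pi * \<bar>a\<bar>) at_top"
proof (cases "a = 0")
  case False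
  then have "\<bar>a\<bar> > 0" "a\<^sup>2 > 0" by simp_all
  then show ?thesis unfolding coulson_def[abs_def] by real_asymp
qed (simp add: coulson_def[abs_def])

lemma sum_list_tendsto:
  fixes f :: "'a \<Rightarrow> 'b \<Rightarrow> 'c::topological_monoid_add"
  assumes "\<And>x. x \<in> set xs \<Longrightarrow> (f x \<longlongrightarrow> l x) F"
  shows "((\<lambda>t. \<Sum>x\<leftarrow>xs. f x t) \<longlongrightarrow> (\<Sum>x\<leftarrow>xs. l x)) F"
  using assms by (induction xs) (auto intro!: tendsto_add)

text \<open>The correction \<open>ln (t\<^sup>2)\<close> enters only through the length, so it
  cancels between lists of equal length.\<close>

lemma sum_list_coulson_has_derivative:
  assumes "t > 0"
  shows "((\<lambda>t. \<Sum>a\<leftarrow>as. coulson a t) has_real_derivative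
    ln (\<Prod>a\<leftarrow>as. t\<^sup>2 + a\<^sup>2) - length as * ln (t\<^sup>2)) (at t)"
proof (induction as)
  case (Cons a as)
  have "(\<Prod>a\<leftarrow>as. t\<^sup>2 + a\<^sup>2) > 0"
    using assms by (induction as) (auto intro!: mult_pos_pos add_pos_nonneg)
  moreover have "t\<^sup>2 + a\<^sup>2 > 0"
    using assms by (simp add: add_pos_nonneg)
  ultimately have "ln (\<Prod>a\<leftarrow>a # as. t\<^sup>2 + a\<^sup>2) = ln (t\<^sup>2 + a\<^sup>2) + ln (\<Prod>a\<leftarrow>as. t\<^sup>2 + a\<^sup>2)"
    by (simp only: list.map prod_list.Cons ln_mult_pos)
  with DERIV_add[OF coulson_has_derivative[OF assms, of a] Cons.IH] show ?case
    by (simp add: algebra_simps)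
qed simp

text \<open>The difference \<open>D\<close> of the two sums has positive derivative on
  \<open>t > 0\<close>, limit 0 at 0, and limit pi times the difference of the absolute sums at
  infinity.\<close>

lemma sum_abs_less_if_prod_less:
  fixes as bs :: "real list"
  assumes len: "length as = length bs"
    and less: "\<And>t. t > 0 \<Longrightarrow> (\<Prod>b\<leftarrow>bs. t\<^sup>2 + b\<^sup>2) < (\<Prod>a\<leftarrow>as. t\<^sup>2 + a\<^sup>2)"
  shows "(\<Sum>b\<leftarrow>bs. \<bar>b\<bar>) < (\<Sum>a\<leftarrow>as. \<bar>a\<bar>)"
proof -
  define D where "D t = (\<Sum>a\<leftarrow>as. coulson a t) - (\<Sum>b\<leftarrow>bs. coulson b t)" for t
  have mono: "D s < D t" if "0 < s" "s < t" for s t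
  proof (rule DERIV_pos_imp_increasing[OF that(2)])
    fix x assume "s \<le> x" "x \<le> t"
    with that have x: "x > 0" by simp
    have "(\<Prod>b\<leftarrow>bs. x\<^sup>2 + b\<^sup>2) > 0"
      using x by (induction bs) (auto intro!: mult_pos_pos add_pos_nonneg)
    with less[OF x] have "ln (\<Prod>b\<leftarrow>bs. x\<^sup>2 + b\<^sup>2) < ln (\<Prod>a\<leftarrow>as. x\<^sup>2 + a\<^sup>2)"
      by simp
    moreover have "(D has_real_derivative
        ln (\<Prod>a\<leftarrow>as. x\<^sup>2 + a\<^sup>2) - ln (\<Prod>b\<leftarrow>bs. x\<^sup>2 + b\<^sup>2)) (at x)"
      using DERIV_diff[OF sum_list_coulson_has_derivative[OF x, of as]
          sum_list_coulson_has_derivative[OF x, of bs]] len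
      by (simp add: D_def[abs_def])
    ultimately show "\<exists>y. (D has_real_derivative y) (at x) \<and> y > 0"
      by force
  qed
  have "(D \<longlongrightarrow> (\<Sum>a\<leftarrow>as. 0) - (\<Sum>b\<leftarrow>bs. 0)) (at_right 0)"
    unfolding D_def[abs_def] by (intro tendsto_diff sum_list_tendsto coulson_at_right_0)
  then have "(D \<longlongrightarrow> 0) (at_right 0)"
    by simp
  moreover have "eventually (\<lambda>t. D t \<le> D 1) (at_right 0)"
    unfolding eventually_at_right_field by (intro exI[of _ 1]) (auto intro: less_imp_le mono)
  ultimately have "0 \<le> D 1"
    by (rule tendsto_upperbound) simp
  \<comment> \<open>The limits give only weak bounds; strictness comes from two interior
    points.\<close>
  also have "D 1 < D 2"
    by (rule mono) simp_all
  also have "D 2 \<le> (\<Sum>a\<leftarrow>as. pi * \<bar>a\<bar>) - (\<Sum>b\<leftarrow>bs. pi * \<bar>b\<bar>)"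
  proof (rule tendsto_lowerbound)
    show "(D \<longlongrightarrow> (\<Sum>a\<leftarrow>as. pi * \<bar>a\<bar>) - (\<Sum>b\<leftarrow>bs. pi * \<bar>b\<bar>)) at_top"
      unfolding D_def[abs_def] by (intro tendsto_diff sum_list_tendsto coulson_at_top)
    show "eventually (\<lambda>t. D 2 \<le> D t) at_top"
      using eventually_gt_at_top[of 2] by eventually_elim (simp add: less_imp_le mono)
  qed simp
  finally show ?thesis
    by (simp add: sum_list_const_mult)
qed

subsection \<open>Energy as a sum over real eigenvalues\<close>

lemma adjacency_matrix_lessThan:
  assumes "pverts G = {..<n}"
  shows "adjacency_matrix G = mat n n (\<lambda>(i, j). if (i, j) \<in> parcs G then 1 else 0)"
proof -
  have "sorted_list_of_set {..<n} = [0..<n]"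
    by (simp add: lessThan_atLeast0)
  then show ?thesis
    unfolding adjacency_matrix_def Let_def assms by (intro eq_matI) auto
qed

text \<open>For an eigenvector \<open>v\<close>, the Hermitian form \<open>S\<close> of
  \<open>A\<close> at \<open>v\<close> is \<open>z\<close> times the squared norm \<open>N\<close>.
  A real symmetric \<open>A\<close> makes \<open>S\<close> its own conjugate, and \<open>N\<close>
  is nonzero.\<close>

lemma symmetric_real_eigenvalue_real:
  fixes A :: "complex mat"
  assumes A: "A \<in> carrier_mat n n" and sym: "transpose_mat A = A"
    and real: "\<And>i j. i < n \<Longrightarrow> j < n \<Longrightarrow> A $$ (i, j) \<in> \<real>"
    and ev: "eigenvalue A z"
  shows "z \<in> \<real>"
proof -
  obtain v where v: "v \<in> carrier_vec n" "v \<noteq> 0\<^sub>v n" "A *\<^sub>v v = z \<cdot>\<^sub>v v"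
    using ev A by (auto simp: eigenvalue_def eigenvector_def)
  define S where "S = (\<Sum>i<n. \<Sum>j<n. cnj (v $ i) * A $$ (i, j) * v $ j)"
  define N where "N = (\<Sum>i<n. (cmod (v $ i))\<^sup>2)"
  have row: "(\<Sum>j<n. A $$ (i, j) * v $ j) = z * v $ i" if "i < n" for i
  proof -
    have "(A *\<^sub>v v) $ i = z * v $ i"
      using v that by simp
    then show ?thesis
      using A v(1) that by (simp add: scalar_prod_def lessThan_atLeast0)
  qed
  have "S = (\<Sum>i<n. cnj (v $ i) * (\<Sum>j<n. A $$ (i, j) * v $ j))"
    by (simp add: S_def sum_distrib_left mult.assoc)
  also have "\<dots> = (\<Sum>i<n. z * of_real ((cmod (v $ i))\<^sup>2))"
    by (intro sum.cong refl) (simp only: row lessThan_iff complex_norm_square, simp add: ac_simps)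
  also have "\<dots> = z * of_real N"
    by (simp add: N_def sum_distrib_left)
  finally have S: "S = z * of_real N" .
  have Aij: "cnj (A $$ (i, j)) = A $$ (j, i)" if "i < n" "j < n" for i j
  proof -
    have "A $$ (j, i) = transpose_mat A $$ (i, j)"
      using A that by simp
    then show ?thesis
      using real[OF that] sym by (simp add: Reals_cnj_iff)
  qed
  have "cnj S = (\<Sum>i<n. \<Sum>j<n. cnj (v $ j) * A $$ (j, i) * v $ i)"
    unfolding S_def cnj_sum by (intro sum.cong refl) (simp add: Aij)
  also have "\<dots> = S"
    unfolding S_def by (rule sum.swap)
  finally have "cnj z * of_real N = z * of_real N"
    by (simp add: S)
  moreover have "N \<noteq> 0"
  proof
    assume "N = 0"
    then have "\<forall>i<n. v $ i = 0"
      by (simp add: N_def sum_nonneg_eq_0_iff)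
    with v(1,2) show False
      by (metis carrier_vecD eq_vecI index_zero_vec)
  qed
  ultimately show ?thesis
    by (simp add: Reals_cnj_iff)
qed

lemma order_prod_list_linear:
  fixes as :: "'a::idom list"
  shows "Polynomial.order x (\<Prod>a\<leftarrow>as. [:- a, 1:]) = count_list as x"
proof (induction as)
  case (Cons a as)
  have nz: "(\<Prod>a\<leftarrow>as. [:- a, 1:]) \<noteq> 0"
    by (auto simp: prod_list_zero_iff)
  have "[:- a, 1:] * (\<Prod>a\<leftarrow>as. [:- a, 1:]) \<noteq> 0"
    by (intro no_zero_divisors nz) simp
  from order_mult[OF this] Cons.IH show ?case
    by (simp add: order_linear' order_linear)
qed simp

lemma sum_list_eq_sum_count_list:
  fixes f :: "'a \<Rightarrow> 'b::semiring_1"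
  assumes "finite S" "set xs \<subseteq> S"
  shows "(\<Sum>x\<leftarrow>xs. f x) = (\<Sum>x\<in>S. of_nat (count_list xs x) * f x)"
  using assms(2)
proof (induction xs)
  case (Cons a xs)
  have "(\<Sum>x\<in>S. of_nat (count_list (a # xs) x) * f x) =
      (\<Sum>x\<in>S. (if x = a then f x else 0) + of_nat (count_list xs x) * f x)"
    by (intro sum.cong refl) (simp add: algebra_simps)
  also have "\<dots> = f a + (\<Sum>x\<in>S. of_nat (count_list xs x) * f x)"
    using assms(1) Cons.prems by (simp add: sum.distrib)
  finally show ?case
    using Cons by simp
qed simp

text \<open>The characteristic polynomial splits over the complex numbers, so its roots form a list
  in which multiplicity is repetition; symmetry makes them real. Each root \<open>a\<close>
  contributes the factor \<open>t\<^sup>2 + a\<^sup>2\<close>, the squared modulus of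
  \<open>it - a\<close>.\<close>

lemma energy_eq_sum_list:
  assumes "pair_graph G" "pverts G = {..<n}"
  obtains as :: "real list" where "length as = n" "energy G = (\<Sum>a\<leftarrow>as. \<bar>a\<bar>)"
    "\<And>t. (\<Prod>a\<leftarrow>as. t\<^sup>2 + a\<^sup>2) = (cmod (poly (char_poly (adjacency_matrix G)) (\<i> * of_real t)))\<^sup>2"
proof -
  interpret pair_graph G by fact
  let ?A = "adjacency_matrix G"
  have A: "?A \<in> carrier_mat n n"
    by (simp add: adjacency_matrix_lessThan[OF assms(2)])
  obtain zs where zs: "char_poly ?A = (\<Prod>z\<leftarrow>zs. [:- z, 1:])" "length zs = n"
    using char_poly_factorized[OF A] by blast
  have poly: "poly (char_poly ?A) x = (\<Prod>z\<leftarrow>zs. x - z)" for x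
    unfolding zs(1) by (induction zs) (simp_all add: algebra_simps)
  have ev: "eigenvalue ?A x \<longleftrightarrow> x \<in> set zs" for x
    unfolding eigenvalue_root_char_poly[OF A] poly by (auto simp: prod_list_zero_iff)
  have sym: "(j, i) \<in> parcs G \<longleftrightarrow> (i, j) \<in> parcs G" for i j
    using pair_sym_arcs by (auto simp: symmetric_def sym_def)
  have "transpose_mat ?A = ?A"
    unfolding adjacency_matrix_lessThan[OF assms(2)] by (intro eq_matI) (auto simp: sym)
  then have real: "z \<in> \<real>" if "z \<in> set zs" for z
    by (rule symmetric_real_eigenvalue_real[OF A])
       (use that in \<open>simp_all add: ev\<close>, simp add: adjacency_matrix_lessThan[OF assms(2)])
  define as where "as = map Re zs"
  have zs_as: "zs = map of_real as"
    unfolding as_def map_map using real by (intro map_idI[symmetric]) simp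
  have "energy G = (\<Sum>x\<in>set zs. real (count_list zs x) * cmod x)"
    by (simp add: energy_def ev zs(1) order_prod_list_linear)
  also have "\<dots> = (\<Sum>z\<leftarrow>zs. cmod z)"
    by (simp add: sum_list_eq_sum_count_list[of "set zs"])
  also have "\<dots> = (\<Sum>a\<leftarrow>as. \<bar>a\<bar>)"
    by (simp add: zs_as o_def)
  finally have "energy G = (\<Sum>a\<leftarrow>as. \<bar>a\<bar>)" .
  moreover have "(\<Prod>a\<leftarrow>as. t\<^sup>2 + a\<^sup>2) = (cmod (poly (char_poly ?A) (\<i> * of_real t)))\<^sup>2" for t
    unfolding poly zs_as
    by (induction as) (simp_all add: norm_mult power_mult_distrib cmod_power2 add.commute)
  moreover have "length as = n"
    using zs(2) by (simp add: as_def)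
  ultimately show thesis
    using that by blast
qed

subsection \<open>Characteristic polynomials on the imaginary axis\<close>

text \<open>The characteristic determinant with a separate variable at each vertex. Eliminating a
  leaf changes only the diagonal entry of its neighbour, so this class is closed under
  pruning.\<close>

definition weighted_det :: "nat pair_pre_digraph \<Rightarrow> (nat \<Rightarrow> complex) \<Rightarrow> complex" where
  "weighted_det G d = (let n = card (pverts G) in
     det (mat n n (\<lambda>(i, j). if i = j then d i else if (i, j) \<in> parcs G then - 1 else 0)))"

lemma weighted_det_lessThan:
  assumes "pverts G = {..<n}"
  shows "weighted_det G d = det (mat n n (\<lambda>(i, j). if i = j then d i else if (i, j) \<in> parcs G then - 1 else 0))"
  by (simp add: weighted_det_def assms)

lemma poly_char_poly_adjacency_matrix:
  assumes "pair_graph G" "pverts G = {..<n}"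
  shows "poly (char_poly (adjacency_matrix G)) x = weighted_det G (\<lambda>_. x)"
proof -
  interpret pair_graph G by fact
  have "(i, i) \<notin> parcs G" for i
    using pair_no_loops by fastforce
  then show ?thesis
    unfolding weighted_det_lessThan[OF assms(2)] char_poly_def
    by (intro poly_det_cong[of _ n])
       (auto simp: char_poly_matrix_def adjacency_matrix_lessThan[OF assms(2)])
qed

lemma weighted_det_cong:
  assumes "pverts G = {..<n}" "\<And>i. i < n \<Longrightarrow> d i = d' i"
  shows "weighted_det G d = weighted_det G d'"
  unfolding weighted_det_lessThan[OF assms(1)] by (intro arg_cong[of _ _ det] eq_matI) (auto simp: assms(2))

text \<open>Adding \<open>1 / d m\<close> times the row of the leaf to the row of \<open>v\<close> clears the last column above the diagonal.\<close>

lemma weighted_det_attach_leaf: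
  assumes "pair_graph G" "pverts G = {..<m}" "v < m" "d m \<noteq> 0"
  shows "weighted_det (attach_leaf v G) d = d m * weighted_det G (d(v := d v - 1 / d m))"
proof -
  interpret pair_graph G by fact
  have out: "(i, j) \<notin> parcs G" if "i = m \<or> j = m" for i j
    using that assms(2) in_arcsD1 in_arcsD2 by fastforce
  have arcs: "parcs (attach_leaf v G) = parcs G \<union> {(v, m), (m, v)}"
    by (simp add: attach_leaf_def Let_def assms(2))
  define M where "M = mat (Suc m) (Suc m)
    (\<lambda>(i, j). if i = j then d i else if (i, j) \<in> parcs (attach_leaf v G) then - 1 else 0)"
  define N where "N = mat m m (\<lambda>(i, j). if i = j then (d(v := d v - 1 / d m)) i
    else if (i, j) \<in> parcs G then - 1 else 0)"
  have "weighted_det (attach_leaf v G) d = det M"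
    by (simp add: weighted_det_lessThan[OF pair_graph_attach_leaf(2)[OF assms(1-3)]] M_def)
  also have "\<dots> = det (addrow (1 / d m) v m M)"
    using assms(3) by (intro det_addrow[symmetric, of _ "Suc m"]) (auto simp: M_def)
  also have "addrow (1 / d m) v m M =
      four_block_mat N (0\<^sub>m m 1) (mat 1 m (\<lambda>(i, j). M $$ (m, j))) (mat 1 1 (\<lambda>_. d m))"
    using assms(3,4)
    by (intro eq_matI) (auto simp: mat_addrow_def M_def N_def arcs out less_Suc_eq)
  also have "det \<dots> = det N * d m"
    by (subst det_four_block_mat_upper_right_zero_col) (auto simp: N_def det_single)
  finally show ?thesis
    by (simp add: weighted_det_lessThan[OF assms(2)] N_def)
qed

text \<open>
  With weights on the imaginary axis the correction \<open>- 1 / (\<i> x)\<close> is \<open>\<i> / x\<close>, so that positive weights stay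
  positive under elimination and all divisions are legitimate.
\<close>

definition imag_det :: "nat pair_pre_digraph \<Rightarrow> (nat \<Rightarrow> real) \<Rightarrow> complex" where
  "imag_det G e = weighted_det G (\<lambda>i. \<i> * of_real (e i))"

lemma imag_det_cong:
  assumes "pverts G = {..<n}" "\<And>i. i < n \<Longrightarrow> e i = e' i"
  shows "imag_det G e = imag_det G e'"
  unfolding imag_det_def by (rule weighted_det_cong[OF assms(1)]) (simp add: assms(2))

lemma imag_det_attach_leaf:
  assumes "pair_graph G" "pverts G = {..<m}" "v < m" "e m \<noteq> 0"
  shows "imag_det (attach_leaf v G) e = \<i> * of_real (e m) * imag_det G (e(v := e v + 1 / e m))"
proof -
  have "(\<lambda>i. \<i> * of_real (e i))(v := \<i> * of_real (e v) - 1 / (\<i> * of_real (e m))) =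
      (\<lambda>i. \<i> * of_real ((e(v := e v + 1 / e m)) i))"
    using assms(4) by (auto simp: fun_eq_iff divide_simps algebra_simps)
  then show ?thesis
    unfolding imag_det_def by (subst weighted_det_attach_leaf[OF assms(1-3)]) (use assms(4) in simp_all)
qed

text \<open>
  For the path on \<open>l\<close> vertices with characteristic polynomial \<open>\<phi>\<^sub>l\<close>, \<open>path_poly t l\<close> is \<open>\<phi>\<^sub>l(it) / i\<^sup>l\<close>, and
  \<open>path_ratio t l\<close> is the quotient \<open>path_poly t (l - 1) / path_poly t l\<close>, with value \<open>0\<close> for the empty path.
\<close>

primrec path_ratio :: "real \<Rightarrow> nat \<Rightarrow> real" where
  "path_ratio t 0 = 0"
| "path_ratio t (Suc l) = 1 / (t + path_ratio t l)"

primrec path_poly :: "real \<Rightarrow> nat \<Rightarrow> real" where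
  "path_poly t 0 = 1"
| "path_poly t (Suc l) = path_poly t l * (t + path_ratio t l)"

lemma path_ratio_nonneg: "t > 0 \<Longrightarrow> path_ratio t l \<ge> 0"
  by (induction l) simp_all

lemma path_poly_mult_ratio:
  assumes "t > 0"
  shows "path_poly t (Suc l) * path_ratio t (Suc l) = path_poly t l"
  using path_ratio_nonneg[OF assms, of l] assms by simp

text \<open>\<open>path_poly\<close> is defined as a product of elimination pivots; this recovers
  the usual three-term recurrence of path polynomials.\<close>

lemma path_poly_rec:
  assumes "t > 0"
  shows "path_poly t (Suc (Suc l)) = t * path_poly t (Suc l) + path_poly t l"
  using path_poly_mult_ratio[OF assms, of l]
  by (subst path_poly.simps(2)) (simp add: ring_distribs mult.commute del: path_poly.simps path_ratio.simps)

text \<open>The path is pruned from its far end. Only its own vertices must have weight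
  \<open>t\<close>; the weights in \<open>G\<close> stay arbitrary, so further paths can be pruned
  afterwards.\<close>

lemma imag_det_attach_path:
  assumes "pair_graph G" "pverts G = {..<m}" "v < m" "t > 0"
    and "\<And>i. m \<le> i \<Longrightarrow> i < m + l \<Longrightarrow> e i = t"
  shows "imag_det (attach_path l v G) e =
    \<i> ^ l * of_real (path_poly t l) * imag_det G (e(v := e v + path_ratio t l))"
  using assms
proof (induction l arbitrary: m v G e)
  case (Suc l)
  let ?r = "path_ratio t l" and ?G = "attach_leaf v G"
  \<comment> \<open>The first new vertex is \<open>m\<close>; pruning the \<open>l\<close> vertices
    beyond it raises its weight to the pivot \<open>t + ?r\<close>.\<close>
  let ?e = "e(m := t + ?r)"
  have G': "pair_graph ?G" "pverts ?G = {..<Suc m}"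
    using pair_graph_attach_leaf[OF Suc.prems(1-3)] by auto
  have pos: "t + ?r > 0"
    using path_ratio_nonneg[OF Suc.prems(4), of l] Suc.prems(4) by simp
  have "imag_det (attach_path (Suc l) v G) e = imag_det (attach_path l m ?G) e"
    by (simp add: Suc.prems(2))
  also have "\<dots> = \<i> ^ l * of_real (path_poly t l) * imag_det ?G ?e"
    using Suc.IH[OF G', of m e] Suc.prems(4,5) by (simp add: fun_upd_def)
  also have "imag_det ?G ?e = \<i> * of_real (t + ?r) * imag_det G (?e(v := ?e v + 1 / (t + ?r)))"
    using pos by (subst imag_det_attach_leaf[OF Suc.prems(1-3)]) simp_all
  also have "imag_det G (?e(v := ?e v + 1 / (t + ?r))) = imag_det G (e(v := e v + path_ratio t (Suc l)))"
    using Suc.prems(3) by (intro imag_det_cong[OF Suc.prems(2)]) auto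
  finally show ?case
    by (simp add: fun_upd_def)
qed simp

text \<open>All paths hang at 0, so their ratios add up in the weight of that vertex.
  \<open>fold\<close> attaches the head first, hence the tail is pruned first.\<close>

lemma imag_det_fold_attach_path:
  assumes "pair_graph G" "pverts G = {..<m}" "0 < m" "t > 0"
    and "\<And>i. m \<le> i \<Longrightarrow> e i = t"
  shows "imag_det (fold (\<lambda>a. attach_path a 0) as G) e =
    \<i> ^ sum_list as * of_real (\<Prod>a\<leftarrow>as. path_poly t a) *
      imag_det G (e(0 := e 0 + (\<Sum>a\<leftarrow>as. path_ratio t a)))"
  using assms
proof (induction as arbitrary: m G)
  case (Cons a as)
  let ?G = "attach_path a 0 G" and ?e = "e(0 := e 0 + (\<Sum>a\<leftarrow>as. path_ratio t a))"
  have G': "pair_graph ?G" "pverts ?G = {..<m + a}"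
    using pair_graph_attach_path[OF Cons.prems(1-3)] by auto
  have "imag_det ?G ?e = \<i> ^ a * of_real (path_poly t a) * imag_det G (?e(0 := ?e 0 + path_ratio t a))"
    using Cons.prems(3,5) by (intro imag_det_attach_path[OF Cons.prems(1-4)]) auto
  moreover have "?e(0 := ?e 0 + path_ratio t a) = e(0 := e 0 + (\<Sum>a\<leftarrow>a # as. path_ratio t a))"
    by (simp add: fun_eq_iff)
  ultimately show ?case
    using Cons.IH[OF G'] Cons.prems(3-5) by (simp add: power_add mult_ac del: fun_upd_apply)
qed simp

lemma imag_det_path_graph_1: "imag_det (path_graph (Suc 0)) e = \<i> * of_real (e 0)"
proof -
  have "pverts (path_graph (Suc 0)) = {..<1}"
    by (simp add: path_graph_def)
  then show ?thesis
    unfolding imag_det_def by (simp add: weighted_det_lessThan[of _ 1] det_single)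
qed

lemma imag_det_P_tree:
  assumes "t > 0"
  shows "imag_det (P_tree as) (\<lambda>_. t) = \<i> ^ Suc (sum_list as) *
    of_real ((\<Prod>a\<leftarrow>as. path_poly t a) * (t + (\<Sum>a\<leftarrow>as. path_ratio t a)))"
proof -
  have "pverts (path_graph 1) = {..<1}"
    by (simp add: path_graph_def)
  from imag_det_fold_attach_path[OF pair_graph_path_graph this _ assms, of "\<lambda>_. t" as]
  show ?thesis
    unfolding P_tree_def by (simp add: imag_det_path_graph_1 mult_ac)
qed

section \<open>Paths with altered end weights, and trees with two branching vertices\<close>

fun linear_rec :: "real \<Rightarrow> real \<Rightarrow> real \<Rightarrow> nat \<Rightarrow> real" where
  "linear_rec t a b 0 = a"
| "linear_rec t a b (Suc 0) = b"
| "linear_rec t a b (Suc (Suc k)) = t * linear_rec t a b (Suc k) + linear_rec t a b k"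

lemma parcs_path_graph_Suc_Suc:
  "parcs (path_graph (Suc (Suc k))) = parcs (path_graph (Suc k)) \<union> {(k, Suc k), (Suc k, k)}"
proof -
  have "(i, j) \<in> parcs (path_graph (Suc (Suc k))) \<longleftrightarrow>
      (i, j) \<in> parcs (path_graph (Suc k)) \<union> {(k, Suc k), (Suc k, k)}" for i j
    by (cases "j = Suc i"; cases "i = Suc j"; simp add: path_graph_def; linarith)
  then show ?thesis
    unfolding set_eq_iff split_paired_All by blast
qed

lemma path_graph_Suc_Suc: "path_graph (Suc (Suc k)) = attach_leaf k (path_graph (Suc k))"
proof (rule pair_pre_digraph.equality)
  have V: "pverts (path_graph m) = {..<m}" for m
    by (simp add: path_graph_def)
  show "pverts (path_graph (Suc (Suc k))) = pverts (attach_leaf k (path_graph (Suc k)))"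
    by (simp only: attach_leaf_def Let_def pair_pre_digraph.simps V lessThan_Suc)
      (simp add: V)
  show "parcs (path_graph (Suc (Suc k))) = parcs (attach_leaf k (path_graph (Suc k)))"
    by (simp only: attach_leaf_def Let_def pair_pre_digraph.simps V card_lessThan
        parcs_path_graph_Suc_Suc)
qed simp

text \<open>Removing the last vertex, of weight \<open>z\<close>, turns the weight of its
  predecessor into \<open>t + 1 / z\<close>. The induction therefore runs over all positive end
  weights.\<close>

lemma imag_det_path_graph:
  assumes "t > 0" "z > 0"
  shows "imag_det (path_graph (Suc (Suc k))) ((\<lambda>_. t)(0 := s, Suc k := z)) =
    \<i> ^ Suc (Suc k) * of_real (z * linear_rec t 1 s (Suc k) + linear_rec t 1 s k)"
  using assms(2)
proof (induction k arbitrary: z)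
  case 0
  have "pverts (path_graph (Suc 0)) = {..<1}"
    by (simp add: path_graph_def)
  from imag_det_attach_leaf[OF pair_graph_path_graph this, of 0 "(\<lambda>_. t)(0 := s, Suc 0 := z)"] 0
  have "imag_det (path_graph (Suc (Suc 0))) ((\<lambda>_. t)(0 := s, Suc 0 := z)) =
      \<i> * of_real z * (\<i> * of_real (s + 1 / z))"
    by (simp add: path_graph_Suc_Suc imag_det_path_graph_1)
  also have "\<dots> = \<i> ^ Suc (Suc 0) * of_real (z * (s + 1 / z))"
    by (simp only: of_real_mult power_Suc power_0 mult_ac mult_1)
  also have "z * (s + 1 / z) = z * linear_rec t 1 s (Suc 0) + linear_rec t 1 s 0"
    using 0 by (simp add: field_simps)
  finally show ?case .
next
  case (Suc k)
  let ?e = "(\<lambda>_. t)(0 := s, Suc (Suc k) := z)"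
  have V: "pverts (path_graph (Suc (Suc k))) = {..<Suc (Suc k)}"
    by (simp add: path_graph_def)
  have pos: "t + 1 / z > 0"
    using assms(1) Suc.prems by (simp add: add_pos_pos)
  have "imag_det (path_graph (Suc (Suc (Suc k)))) ?e =
      \<i> * of_real z * imag_det (path_graph (Suc (Suc k))) (?e(Suc k := t + 1 / z))"
    using imag_det_attach_leaf[OF pair_graph_path_graph V, of "Suc k" ?e] Suc.prems
    by (simp add: path_graph_Suc_Suc[of "Suc k"])
  also have "imag_det (path_graph (Suc (Suc k))) (?e(Suc k := t + 1 / z)) =
      imag_det (path_graph (Suc (Suc k))) ((\<lambda>_. t)(0 := s, Suc k := t + 1 / z))"
    by (rule imag_det_cong[OF V]) auto
  also note Suc.IH[OF pos]
  also have "\<i> * of_real z * (\<i> ^ Suc (Suc k) *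
        of_real ((t + 1 / z) * linear_rec t 1 s (Suc k) + linear_rec t 1 s k)) =
      \<i> ^ Suc (Suc (Suc k)) *
        of_real (z * ((t + 1 / z) * linear_rec t 1 s (Suc k) + linear_rec t 1 s k))"
    by (simp only: of_real_mult power_Suc mult_ac)
  also have "z * ((t + 1 / z) * linear_rec t 1 s (Suc k) + linear_rec t 1 s k) =
      z * linear_rec t 1 s (Suc (Suc k)) + linear_rec t 1 s (Suc k)"
    using Suc.prems by (simp add: field_simps)
  finally show ?case .
qed

text \<open>Pruning the four pendent paths in reverse order of attachment leaves the central path,
  with end weights \<open>s\<close> and \<open>z\<close>.\<close>

lemma imag_det_T_tree:
  fixes t :: real and a b c d :: nat
  defines "s \<equiv> t + path_ratio t a + path_ratio t b"
    and "z \<equiv> t + path_ratio t c + path_ratio t d"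
  assumes t: "t > 0" and n: "n = Suc (Suc k) + (a + b + c + d)"
  shows "imag_det (T_tree n a b c d) (\<lambda>_. t) = \<i> ^ n *
    of_real (path_poly t a * path_poly t b * path_poly t c * path_poly t d *
      (z * linear_rec t 1 s (Suc k) + linear_rec t 1 s k))"
proof -
  have ipow_mult: "(\<i> ^ i * of_real x) * (\<i> ^ j * of_real y) = \<i> ^ (i + j) * of_real (x * y)"
    for i j and x y :: real
    by (simp add: power_add)
  \<comment> \<open>The central path has \<open>k + 2\<close> vertices, so its ends 0 and
    \<open>?v\<close> are distinct.\<close>
  let ?m = "Suc (Suc k)" and ?v = "Suc k"
  let ?r = "path_ratio t"
  define G1 where "G1 = attach_path a 0 (path_graph ?m)"
  define G2 where "G2 = attach_path b 0 G1"
  define G3 where "G3 = attach_path c ?v G2"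
  have 0: "pair_graph (path_graph ?m)" "pverts (path_graph ?m) = {..<?m}"
    by (simp_all add: pair_graph_path_graph) (simp add: path_graph_def)
  have 1: "pair_graph G1" "pverts G1 = {..<?m + a}"
    using pair_graph_attach_path[OF 0, of 0] by (simp_all add: G1_def)
  have 2: "pair_graph G2" "pverts G2 = {..<?m + a + b}"
    using pair_graph_attach_path[OF 1, of 0] by (simp_all add: G2_def)
  have 3: "pair_graph G3" "pverts G3 = {..<?m + a + b + c}"
    using pair_graph_attach_path[OF 2, of ?v] by (simp_all add: G3_def)
  define e3 where "e3 = (\<lambda>_. t)(?v := t + ?r d)"
  define e2 where "e2 = e3(?v := e3 ?v + ?r c)"
  define e1 where "e1 = e2(0 := e2 0 + ?r b)"
  define e0 where "e0 = e1(0 := e1 0 + ?r a)"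
  have "T_tree n a b c d = attach_path d ?v G3"
    by (simp add: T_tree_def n G1_def G2_def G3_def)
  then have "imag_det (T_tree n a b c d) (\<lambda>_. t) = \<i> ^ d * of_real (path_poly t d) * imag_det G3 e3"
    using imag_det_attach_path[OF 3, of ?v t d "\<lambda>_. t"] t by (simp add: e3_def)
  also have "imag_det G3 e3 = \<i> ^ c * of_real (path_poly t c) * imag_det G2 e2"
    unfolding G3_def e2_def using t by (intro imag_det_attach_path[OF 2]) (auto simp: e3_def)
  also have "imag_det G2 e2 = \<i> ^ b * of_real (path_poly t b) * imag_det G1 e1"
    unfolding G2_def e1_def using t by (intro imag_det_attach_path[OF 1]) (auto simp: e2_def e3_def)
  also have "imag_det G1 e1 = \<i> ^ a * of_real (path_poly t a) * imag_det (path_graph ?m) e0"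
    unfolding G1_def e0_def using t by (intro imag_det_attach_path[OF 0]) (auto simp: e1_def e2_def e3_def)
  also have "e0 = (\<lambda>_. t)(0 := s, ?v := z)"
    by (auto simp: e0_def e1_def e2_def e3_def s_def z_def fun_eq_iff)
  also have "imag_det (path_graph ?m) ((\<lambda>_. t)(0 := s, ?v := z)) =
      \<i> ^ ?m * of_real (z * linear_rec t 1 s (Suc k) + linear_rec t 1 s k)"
    using t path_ratio_nonneg[OF t, of c] path_ratio_nonneg[OF t, of d]
    by (intro imag_det_path_graph) (simp_all add: z_def)
  finally have "imag_det (T_tree n a b c d) (\<lambda>_. t) =
      \<i> ^ d * of_real (path_poly t d) * (\<i> ^ c * of_real (path_poly t c) *
      (\<i> ^ b * of_real (path_poly t b) * (\<i> ^ a * of_real (path_poly t a) *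
      (\<i> ^ ?m * of_real (z * linear_rec t 1 s (Suc k) + linear_rec t 1 s k)))))" .
  also have "\<dots> = \<i> ^ (d + (c + (b + (a + ?m)))) * of_real (path_poly t d * (path_poly t c *
      (path_poly t b * (path_poly t a * (z * linear_rec t 1 s (Suc k) + linear_rec t 1 s k)))))"
    by (simp only: ipow_mult)
  also have "d + (c + (b + (a + ?m))) = n"
    using n by simp
  also have "path_poly t d * (path_poly t c *
        (path_poly t b * (path_poly t a * (z * linear_rec t 1 s (Suc k) + linear_rec t 1 s k)))) =
      path_poly t a * path_poly t b * path_poly t c * path_poly t d *
        (z * linear_rec t 1 s (Suc k) + linear_rec t 1 s k)"
    by simp
  finally show ?thesis .
qed

subsection \<open>The two families of trees\<close>

lemma linear_rec_unique:
  assumes "f 0 = a" "f (Suc 0) = b" "\<And>k. f (Suc (Suc k)) = t * f (Suc k) + f k"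
  shows "f k = linear_rec t a b k"
  by (induction k rule: induct_nat_012) (simp_all add: assms)

lemma linear_rec_nonneg:
  assumes "t \<ge> 0" "a \<ge> 0" "b \<ge> 0"
  shows "linear_rec t a b k \<ge> 0"
  by (induction k rule: induct_nat_012) (simp_all add: assms)

text \<open>The factors \<open>B\<close> and \<open>C\<close> do not depend on \<open>k\<close>, and
  the recurrence has positive coefficients, so two consecutive strict inequalities
  propagate.\<close>

lemma linear_rec_mult_less:
  assumes "t > 0" "a * B < a' * C" "b * B < b' * C"
  shows "linear_rec t a b k * B < linear_rec t a' b' k * C"
proof (induction k rule: induct_nat_012)
  case (ge2 k)
  from add_strict_mono[OF mult_strict_left_mono[OF ge2(2) assms(1)] ge2(1)] show ?case
    by (simp add: algebra_simps)
qed (simp_all add: assms)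

text \<open>Lengths 2 and 6 are those of the fixed pendent paths; lengths 1 and 5 give the
  numerators of their ratios.\<close>

lemma path_poly_small:
  assumes "t > 0"
  shows "path_poly t 1 = t" "path_poly t 2 = t\<^sup>2 + 1"
    "path_poly t 5 = t ^ 5 + 4 * t ^ 3 + 3 * t" "path_poly t 6 = t ^ 6 + 5 * t ^ 4 + 6 * t\<^sup>2 + 1"
proof -
  have rec: "path_poly t (Suc (Suc l)) = t * path_poly t (Suc l) + path_poly t l" for l
    by (rule path_poly_rec[OF assms])
  show 1: "path_poly t 1 = t"
    by simp
  show 2: "path_poly t 2 = t\<^sup>2 + 1"
    using rec[of 0] by (simp add: eval_nat_numeral)
  have 3: "path_poly t 3 = t ^ 3 + 2 * t"
    using rec[of 1] 1 2 by (simp add: eval_nat_numeral algebra_simps del: path_poly.simps(2))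
  have 4: "path_poly t 4 = t ^ 4 + 3 * t\<^sup>2 + 1"
    using rec[of 2] 2 3 by (simp add: eval_nat_numeral algebra_simps del: path_poly.simps(2))
  show 5: "path_poly t 5 = t ^ 5 + 4 * t ^ 3 + 3 * t"
    using rec[of 3] 3 4 by (simp add: eval_nat_numeral algebra_simps del: path_poly.simps(2))
  show "path_poly t 6 = t ^ 6 + 5 * t ^ 4 + 6 * t\<^sup>2 + 1"
    using rec[of 4] 4 5 by (simp add: eval_nat_numeral algebra_simps del: path_poly.simps(2))
qed

text \<open>Clearing the ratios leaves a combination of \<open>path_poly t (Suc k)\<close> and
  \<open>path_poly t k\<close> whose coefficients are free of \<open>k\<close>. It satisfies the
  path recurrence, so its values at \<open>k = 0\<close> and \<open>k = 1\<close> determine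
  it.\<close>

lemma imag_det_P_tree_2_6:
  assumes "t > 0"
  shows "imag_det (P_tree [2, 6, Suc k]) (\<lambda>_. t) = \<i> ^ (k + 10) * of_real (linear_rec t
    (t ^ 10 + 9 * t ^ 8 + 27 * t ^ 6 + 31 * t ^ 4 + 12 * t\<^sup>2 + 1)
    (t ^ 11 + 10 * t ^ 9 + 35 * t ^ 7 + 52 * t ^ 5 + 32 * t ^ 3 + 6 * t) k)"
proof -
  note q = path_poly_small[OF assms]
  \<comment> \<open>\<open>c\<close> belongs to the two fixed branches without the centre, and
    \<open>K\<close> to the path on 9 vertices that they form with it.\<close>
  define c where "c = (t\<^sup>2 + 1) * (t ^ 6 + 5 * t ^ 4 + 6 * t\<^sup>2 + 1)"
  define K where "K = t * c + t * (t ^ 6 + 5 * t ^ 4 + 6 * t\<^sup>2 + 1) +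
    (t\<^sup>2 + 1) * (t ^ 5 + 4 * t ^ 3 + 3 * t)"
  have r2: "(t\<^sup>2 + 1) * path_ratio t 2 = t"
    using path_poly_mult_ratio[OF assms, of 1] q(1,2) by (simp only: Suc_1)
  have "Suc 5 = 6"
    by simp
  then have r6: "(t ^ 6 + 5 * t ^ 4 + 6 * t\<^sup>2 + 1) * path_ratio t 6 = t ^ 5 + 4 * t ^ 3 + 3 * t"
    using path_poly_mult_ratio[OF assms, of 5] q(3,4) by (simp only:)
  \<comment> \<open>The trailing \<open>1\<close> and \<open>0\<close> are the values on empty
    lists, kept so that the rewriting matches syntactically.\<close>
  have expand: "a * (b * (p * 1)) * (t + (u + (v + (w + 0)))) =
      (t * (a * b) + (a * u) * b + a * (b * v)) * p + (a * b) * (p * w)" for a b p u v w :: real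
    by (simp add: algebra_simps)
  have "(\<Prod>a\<leftarrow>[2, 6, Suc k]. path_poly t a) * (t + (\<Sum>a\<leftarrow>[2, 6, Suc k]. path_ratio t a)) =
      (t * c + ((t\<^sup>2 + 1) * path_ratio t 2) * (t ^ 6 + 5 * t ^ 4 + 6 * t\<^sup>2 + 1) +
        (t\<^sup>2 + 1) * ((t ^ 6 + 5 * t ^ 4 + 6 * t\<^sup>2 + 1) * path_ratio t 6)) * path_poly t (Suc k) +
      c * (path_poly t (Suc k) * path_ratio t (Suc k))"
    by (simp only: list.map prod_list.Cons prod_list.Nil sum_list.Cons sum_list.Nil q c_def expand)
  also have "\<dots> = K * path_poly t (Suc k) + c * path_poly t k"
    by (simp only: r2 r6 path_poly_mult_ratio[OF assms] K_def)
  also have "\<dots> = linear_rec t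
    (t ^ 10 + 9 * t ^ 8 + 27 * t ^ 6 + 31 * t ^ 4 + 12 * t\<^sup>2 + 1)
    (t ^ 11 + 10 * t ^ 9 + 35 * t ^ 7 + 52 * t ^ 5 + 32 * t ^ 3 + 6 * t) k"
  proof (rule linear_rec_unique)
    show "K * path_poly t (Suc 0) + c * path_poly t 0 =
        t ^ 10 + 9 * t ^ 8 + 27 * t ^ 6 + 31 * t ^ 4 + 12 * t\<^sup>2 + 1"
      unfolding K_def c_def by (simp add: algebra_simps eval_nat_numeral)
    have "path_poly t (Suc (Suc 0)) = t\<^sup>2 + 1"
      using q(2) by (simp only: numeral_2_eq_2)
    then show "K * path_poly t (Suc (Suc 0)) + c * path_poly t (Suc 0) =
        t ^ 11 + 10 * t ^ 9 + 35 * t ^ 7 + 52 * t ^ 5 + 32 * t ^ 3 + 6 * t"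
      using q(1) unfolding K_def c_def One_nat_def
      by (simp only:) (simp add: algebra_simps eval_nat_numeral)
  qed (simp add: path_poly_rec[OF assms] algebra_simps del: path_poly.simps)
  finally have "(\<Prod>a\<leftarrow>[2, 6, Suc k]. path_poly t a) * (t + (\<Sum>a\<leftarrow>[2, 6, Suc k]. path_ratio t a)) =
    linear_rec t (t ^ 10 + 9 * t ^ 8 + 27 * t ^ 6 + 31 * t ^ 4 + 12 * t\<^sup>2 + 1)
    (t ^ 11 + 10 * t ^ 9 + 35 * t ^ 7 + 52 * t ^ 5 + 32 * t ^ 3 + 6 * t) k" .
  moreover have "Suc (sum_list [2, 6, Suc k]) = k + 10"
    by simp
  ultimately show ?thesis
    unfolding imag_det_P_tree[OF assms] by (simp only:)
qed

lemma imag_det_T_tree_2_2_2_2: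
  assumes "t > 0"
  shows "imag_det (T_tree (k + 10) 2 2 2 2) (\<lambda>_. t) = \<i> ^ (k + 10) * of_real (linear_rec t
    (t ^ 10 + 9 * t ^ 8 + 26 * t ^ 6 + 30 * t ^ 4 + 13 * t\<^sup>2 + 1)
    (t ^ 11 + 10 * t ^ 9 + 34 * t ^ 7 + 48 * t ^ 5 + 29 * t ^ 3 + 6 * t) k)"
proof -
  note q = path_poly_small[OF assms]
  define s where "s = t + path_ratio t 2 + path_ratio t 2"
  let ?u = "linear_rec t 1 s"
  have "(t\<^sup>2 + 1) * path_ratio t 2 = t"
    using path_poly_mult_ratio[OF assms, of 1] q(1,2) by (simp only: Suc_1)
  moreover have "(t\<^sup>2 + 1) * (t + r + r) = t ^ 3 + 3 * t" if "(t\<^sup>2 + 1) * r = t" for r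
  proof -
    have "(t\<^sup>2 + 1) * (t + r + r) = (t\<^sup>2 + 1) * t + 2 * ((t\<^sup>2 + 1) * r)"
      by (simp add: algebra_simps)
    then show ?thesis
      unfolding that by (simp add: algebra_simps eval_nat_numeral)
  qed
  ultimately have s: "(t\<^sup>2 + 1) * s = t ^ 3 + 3 * t"
    unfolding s_def by blast
  \<comment> \<open>With \<open>x = t\<^sup>2 + 1\<close>, the rational function \<open>s\<close> is
    grouped so that it occurs only in the polynomial \<open>x * s\<close>. The two identities serve
    \<open>k = 0\<close> and \<open>k = 1\<close>.\<close>
  have expand: "x * x * x * x * (s * s + 1) = x\<^sup>2 * ((x * s)\<^sup>2 + x\<^sup>2)"
    "x * x * x * x * (s * (t * s + 1) + s) = x\<^sup>2 * (t * (x * s)\<^sup>2 + 2 * x * (x * s))" for x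
    by (simp_all add: power2_eq_square algebra_simps)
  have "(t\<^sup>2 + 1) * (t\<^sup>2 + 1) * (t\<^sup>2 + 1) * (t\<^sup>2 + 1) * (s * ?u (Suc k) + ?u k) = linear_rec t
    (t ^ 10 + 9 * t ^ 8 + 26 * t ^ 6 + 30 * t ^ 4 + 13 * t\<^sup>2 + 1)
    (t ^ 11 + 10 * t ^ 9 + 34 * t ^ 7 + 48 * t ^ 5 + 29 * t ^ 3 + 6 * t) k"
  proof (rule linear_rec_unique)
    have "(t\<^sup>2 + 1) * (t\<^sup>2 + 1) * (t\<^sup>2 + 1) * (t\<^sup>2 + 1) * (s * ?u (Suc 0) + ?u 0) =
        (t\<^sup>2 + 1)\<^sup>2 * (((t\<^sup>2 + 1) * s)\<^sup>2 + (t\<^sup>2 + 1)\<^sup>2)"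
      using expand(1)[of "t\<^sup>2 + 1"] by simp
    also have "\<dots> = t ^ 10 + 9 * t ^ 8 + 26 * t ^ 6 + 30 * t ^ 4 + 13 * t\<^sup>2 + 1"
      unfolding s by (simp add: algebra_simps eval_nat_numeral)
    finally show "(t\<^sup>2 + 1) * (t\<^sup>2 + 1) * (t\<^sup>2 + 1) * (t\<^sup>2 + 1) * (s * ?u (Suc 0) + ?u 0) =
        t ^ 10 + 9 * t ^ 8 + 26 * t ^ 6 + 30 * t ^ 4 + 13 * t\<^sup>2 + 1" .
    have "(t\<^sup>2 + 1) * (t\<^sup>2 + 1) * (t\<^sup>2 + 1) * (t\<^sup>2 + 1) * (s * ?u (Suc (Suc 0)) + ?u (Suc 0)) =
        (t\<^sup>2 + 1)\<^sup>2 * (t * ((t\<^sup>2 + 1) * s)\<^sup>2 + 2 * (t\<^sup>2 + 1) * ((t\<^sup>2 + 1) * s))"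
      using expand(2)[of "t\<^sup>2 + 1"] by simp
    also have "\<dots> = t ^ 11 + 10 * t ^ 9 + 34 * t ^ 7 + 48 * t ^ 5 + 29 * t ^ 3 + 6 * t"
      unfolding s by (simp add: algebra_simps eval_nat_numeral)
    finally show "(t\<^sup>2 + 1) * (t\<^sup>2 + 1) * (t\<^sup>2 + 1) * (t\<^sup>2 + 1) * (s * ?u (Suc (Suc 0)) + ?u (Suc 0)) =
        t ^ 11 + 10 * t ^ 9 + 34 * t ^ 7 + 48 * t ^ 5 + 29 * t ^ 3 + 6 * t" .
  qed (simp add: algebra_simps)
  then show ?thesis
    using imag_det_T_tree[OF assms, of "k + 10" k 2 2 2 2] q(2) by (simp add: s_def)
qed

section \<open>Polynomial inequalities for orders 10 and 11\<close>

lemma mult_less_mult_order_10: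
  fixes t :: real
  shows "(t ^ 10 + 9 * t ^ 8 + 26 * t ^ 6 + 30 * t ^ 4 + 13 * t\<^sup>2 + 1) *
      ((t\<^sup>2 + (5 / 6)\<^sup>2) * (t\<^sup>2 + (5 / 3)\<^sup>2) * (t\<^sup>2 + 2\<^sup>2)) <
    (t ^ 10 + 9 * t ^ 8 + 27 * t ^ 6 + 31 * t ^ 4 + 12 * t\<^sup>2 + 1) *
      ((t\<^sup>2 + 1\<^sup>2) * (t\<^sup>2 + (4 / 3)\<^sup>2) * (t\<^sup>2 + (13 / 6)\<^sup>2))" (is "?l < ?r")
proof -
  define y where "y = t\<^sup>2"
  have y: "y \<ge> 0"
    by (simp add: y_def)
  have p: "t ^ 4 = y ^ 2" "t ^ 6 = y ^ 3" "t ^ 8 = y ^ 4" "t ^ 10 = y ^ 5"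
    by (simp_all add: y_def flip: power_mult)
  have C: "(y + 1\<^sup>2) * (y + (4 / 3)\<^sup>2) * (y + (13 / 6)\<^sup>2) = (y + 1) * (9 * y + 16) * (36 * y + 169) / 324"
    and D: "(y + (5 / 6)\<^sup>2) * (y + (5 / 3)\<^sup>2) * (y + 2\<^sup>2) = (36 * y + 25) * (9 * y + 25) * (y + 4) / 324" for y :: real
    by (simp_all add: power2_eq_square field_simps)
  let ?z = "(y ^ 5 + 9 * y ^ 4 + 27 * y ^ 3 + 31 * y\<^sup>2 + 12 * y + 1) *
      ((y + 1) * (9 * y + 16) * (36 * y + 169)) -
    (y ^ 5 + 9 * y ^ 4 + 26 * y ^ 3 + 30 * y\<^sup>2 + 13 * y + 1) *
      ((36 * y + 25) * (9 * y + 25) * (y + 4))"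
  \<comment> \<open>After cancellation \<open>?z\<close> is
    \<open>33 y^5 + 310 y^4 + 668 y^3 - 189 y^2 - 376 y + 204\<close>. On \<open>y \<ge> 0\<close>
    its minimum lies near \<open>y = 1/2\<close>, so a square centred there absorbs the negative
    coefficients.\<close>
  have "0 < 264 * y ^ 5 + (620 * y\<^sup>2 + 1956 * y + 1423) * (2 * y - 1)\<^sup>2 + 728 * y + 209"
    using y by (intro add_nonneg_pos add_nonneg_nonneg mult_nonneg_nonneg) auto
  also have "\<dots> = 8 * ?z"
    by (simp add: algebra_simps eval_nat_numeral)
  finally have "0 < ?z"
    by (simp only: zero_less_mult_iff) simp
  also have "?z = 324 * (?r - ?l)"
    unfolding p y_def[symmetric] C D by simp
  finally show ?thesis
    by simp
qed

lemma mult_less_mult_order_11: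
  fixes t :: real
  assumes "t > 0"
  shows "(t ^ 11 + 10 * t ^ 9 + 34 * t ^ 7 + 48 * t ^ 5 + 29 * t ^ 3 + 6 * t) *
      ((t\<^sup>2 + (5 / 6)\<^sup>2) * (t\<^sup>2 + (5 / 3)\<^sup>2) * (t\<^sup>2 + 2\<^sup>2)) <
    (t ^ 11 + 10 * t ^ 9 + 35 * t ^ 7 + 52 * t ^ 5 + 32 * t ^ 3 + 6 * t) *
      ((t\<^sup>2 + 1\<^sup>2) * (t\<^sup>2 + (4 / 3)\<^sup>2) * (t\<^sup>2 + (13 / 6)\<^sup>2))" (is "?l < ?r")
proof -
  have C: "(y + 1\<^sup>2) * (y + (4 / 3)\<^sup>2) * (y + (13 / 6)\<^sup>2) = (y + 1) * (9 * y + 16) * (36 * y + 169) / 324"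
    and D: "(y + (5 / 6)\<^sup>2) * (y + (5 / 3)\<^sup>2) * (y + 2\<^sup>2) = (36 * y + 25) * (9 * y + 25) * (y + 4) / 324" for y :: real
    by (simp_all add: power2_eq_square field_simps)
  have "324 * (?r - ?l) =
      (t ^ 11 + 10 * t ^ 9 + 35 * t ^ 7 + 52 * t ^ 5 + 32 * t ^ 3 + 6 * t) *
        ((t\<^sup>2 + 1) * (9 * t\<^sup>2 + 16) * (36 * t\<^sup>2 + 169)) -
      (t ^ 11 + 10 * t ^ 9 + 34 * t ^ 7 + 48 * t ^ 5 + 29 * t ^ 3 + 6 * t) *
        ((36 * t\<^sup>2 + 25) * (9 * t\<^sup>2 + 25) * (t\<^sup>2 + 4))"
    unfolding C D by simp
  \<comment> \<open>The powers 17, 15 and 13 cancel, and unlike for order 10 every remaining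
    coefficient is positive.\<close>
  also have "\<dots> = t * (681 * t ^ 10 + 6481 * t ^ 8 + 20555 * t ^ 6 + 25615 * t ^ 4 + 12084 * t\<^sup>2 + 1224)"
    by (simp add: algebra_simps eval_nat_numeral)
  also have "\<dots> > 0"
    using assms by (intro mult_pos_pos add_nonneg_pos) auto
  finally show ?thesis
    by simp
qed

theorem theorem3p2:
  fixes n :: nat
  assumes "n \<ge> 10"
  shows "energy (P_tree [2, 6, n - 9]) > energy (T_tree n 2 2 2 2)"
proof -
  obtain k where n: "n = k + 10"
    using assms by (metis add.commute le_Suc_ex)
  then have n9: "n - 9 = Suc k"
    by simp
  let ?P = "P_tree [2, 6, Suc k]" and ?T = "T_tree n 2 2 2 2"
  have P: "pair_graph ?P" "pverts ?P = {..<n}"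
    using pair_graph_P_tree[of "[2, 6, Suc k]"] n by simp_all
  have T: "pair_graph ?T" "pverts ?T = {..<n}"
    using pair_graph_T_tree[of 2 2 2 2 n] n by simp_all
  obtain as where as: "length as = n" "energy ?P = (\<Sum>a\<leftarrow>as. \<bar>a\<bar>)"
    "\<And>t. (\<Prod>a\<leftarrow>as. t\<^sup>2 + a\<^sup>2) = (cmod (poly (char_poly (adjacency_matrix ?P)) (\<i> * of_real t)))\<^sup>2"
    by (rule energy_eq_sum_list[OF P]) blast
  obtain bs where bs: "length bs = n" "energy ?T = (\<Sum>b\<leftarrow>bs. \<bar>b\<bar>)"
    "\<And>t. (\<Prod>b\<leftarrow>bs. t\<^sup>2 + b\<^sup>2) = (cmod (poly (char_poly (adjacency_matrix ?T)) (\<i> * of_real t)))\<^sup>2"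
    by (rule energy_eq_sum_list[OF T]) blast
  \<comment> \<open>Besides equal sums, \<open>cs\<close> and \<open>ds\<close> have equal sums of
    squares, 269/36. The product of \<open>cs\<close> is the larger, 26/9 against 25/9, which gives
    room near \<open>t = 0\<close>.\<close>
  define cs :: "real list" where "cs = [1, 4 / 3, 13 / 6]"
  define ds :: "real list" where "ds = [5 / 6, 5 / 3, 2]"
  \<comment> \<open>The products over eigenvalues are squared moduli, so each triple is appended
    twice to square its factor as well.\<close>
  have "(\<Sum>b\<leftarrow>bs @ ds @ ds. \<bar>b\<bar>) < (\<Sum>a\<leftarrow>as @ cs @ cs. \<bar>a\<bar>)"
  proof (rule sum_abs_less_if_prod_less)
    show "length (as @ cs @ cs) = length (bs @ ds @ ds)"
      by (simp add: as(1) bs(1) cs_def ds_def)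
    fix t :: real
    assume t: "t > 0"
    define p where "p = linear_rec t (t ^ 10 + 9 * t ^ 8 + 27 * t ^ 6 + 31 * t ^ 4 + 12 * t\<^sup>2 + 1)
      (t ^ 11 + 10 * t ^ 9 + 35 * t ^ 7 + 52 * t ^ 5 + 32 * t ^ 3 + 6 * t) k"
    define q where "q = linear_rec t (t ^ 10 + 9 * t ^ 8 + 26 * t ^ 6 + 30 * t ^ 4 + 13 * t\<^sup>2 + 1)
      (t ^ 11 + 10 * t ^ 9 + 34 * t ^ 7 + 48 * t ^ 5 + 29 * t ^ 3 + 6 * t) k"
    let ?C = "(t\<^sup>2 + 1\<^sup>2) * (t\<^sup>2 + (4 / 3)\<^sup>2) * (t\<^sup>2 + (13 / 6)\<^sup>2)"
    let ?D = "(t\<^sup>2 + (5 / 6)\<^sup>2) * (t\<^sup>2 + (5 / 3)\<^sup>2) * (t\<^sup>2 + 2\<^sup>2)"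
    have "poly (char_poly (adjacency_matrix ?P)) (\<i> * of_real t) = \<i> ^ n * of_real p"
      using imag_det_P_tree_2_6[OF t, of k]
      by (simp only: poly_char_poly_adjacency_matrix[OF P] imag_det_def n[symmetric] p_def)
    then have p: "(\<Prod>a\<leftarrow>as. t\<^sup>2 + a\<^sup>2) = p\<^sup>2"
      by (simp add: as(3) norm_mult norm_power)
    have "poly (char_poly (adjacency_matrix ?T)) (\<i> * of_real t) = \<i> ^ n * of_real q"
      using imag_det_T_tree_2_2_2_2[OF t, of k]
      by (simp only: poly_char_poly_adjacency_matrix[OF T] imag_det_def n[symmetric] q_def)
    then have q: "(\<Prod>b\<leftarrow>bs. t\<^sup>2 + b\<^sup>2) = q\<^sup>2"
      by (simp add: bs(3) norm_mult norm_power)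
    \<comment> \<open>Nonnegativity of the smaller side allows the inequality to be squared.\<close>
    have "0 \<le> q"
      unfolding q_def using t by (intro linear_rec_nonneg) auto
    then have "0 \<le> q * ?D"
      by (intro mult_nonneg_nonneg) auto
    moreover have "q * ?D < p * ?C"
      unfolding p_def q_def
      by (intro linear_rec_mult_less t mult_less_mult_order_10 mult_less_mult_order_11)
    ultimately have "(q * ?D)\<^sup>2 < (p * ?C)\<^sup>2"
      by (intro power_strict_mono) auto
    also have "(p * ?C)\<^sup>2 = (\<Prod>a\<leftarrow>as @ cs @ cs. t\<^sup>2 + a\<^sup>2)"
      by (simp add: p cs_def) (simp add: power2_eq_square mult_ac)
    also have "(q * ?D)\<^sup>2 = (\<Prod>b\<leftarrow>bs @ ds @ ds. t\<^sup>2 + b\<^sup>2)"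
      by (simp add: q ds_def) (simp add: power2_eq_square mult_ac)
    finally show "(\<Prod>b\<leftarrow>bs @ ds @ ds. t\<^sup>2 + b\<^sup>2) < (\<Prod>a\<leftarrow>as @ cs @ cs. t\<^sup>2 + a\<^sup>2)" .
  qed
  \<comment> \<open>Both doubled triples add 9 to the sums, so they drop out.\<close>
  then show ?thesis
    by (simp add: n9 as(2) bs(2) cs_def ds_def)
qed

end
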